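(* Let $f:SG\to\mathbb R$ be a continuous function with finitely many zeros. Let $Z=\{z_k\}_{k=1}^m$ be the set of zeros of $f$ and set $Z_0=Z\cap V^*$. Then for any connected component $D$ of $SG\setminus Z_0$, either $f\ge0$ on $D$ or $f\le0$ on $D$.
   Context: Let $q_0=(\tfrac12,\tfrac{\sqrt3}{2})$, $q_1=(0,0)$, $q_2=(1,0)$, $V_0=\{q_0,q_1,q_2\}$, $F_i(x)=\tfrac12(x-q_i)+q_i$. The Sierpinski gasket $SG\subset\mathbb R^2$ is the unique nonempty compact set with $SG=\bigcup_{i=0}^2F_i(SG)$. For a word $w=(w_1,\dots,w_m)\in\{0,1,2\}^m$, $|w|=m$, put $F_w=F_{w_1}\circ\cdots\circ F_{w_m}$; $V_m=\bigcup_{|w|=m}F_w(V_0)$ and $V^*=\bigcup_{m\ge0}V_m$ (the set of all vertices). *)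

theory Defs
  imports "HOL-Analysis.Analysis"
begin

(* Only the indices 0, 1, 2 are meaningful; every index from 2 on denotes the vertex q_2. *)
definition q :: "nat \<Rightarrow> real ^ 2" where
  "q i = (if i = 0 then vector [1 / 2, sqrt 3 / 2]
          else if i = 1 then vector [0, 0]
          else vector [1, 0])"

definition V0 :: "(real ^ 2) set" where
  "V0 = {q 0, q 1, q 2}"

definition F :: "nat \<Rightarrow> real ^ 2 \<Rightarrow> real ^ 2" where
  "F i x = (1 / 2) *\<^sub>R (x - q i) + q i"

(* The definite description is proper by Hutchinson's theorem, the F i being contractions. *)
definition SG :: "(real ^ 2) set" where
  "SG = (THE K. K \<noteq> {} \<and> compact K \<and> K = (\<Union>i\<in>{0, 1, 2}. F i ` K))"

definition words :: "nat \<Rightarrow> nat list set" where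
  "words m = {w. length w = m \<and> set w \<subseteq> {0, 1, 2}}"

primrec F_word :: "nat list \<Rightarrow> real ^ 2 \<Rightarrow> real ^ 2" where
  "F_word [] = id"
| "F_word (i # w) = F i \<circ> F_word w"

definition V :: "nat \<Rightarrow> (real ^ 2) set" where
  "V m = (\<Union>w\<in>words m. F_word w ` V0)"

definition Vstar :: "(real ^ 2) set" where
  "Vstar = (\<Union>m. V m)"

end

theory Submission imports Defs begin

text \<open>
  A zero that is not a vertex lies in the interior (relative to the gasket) of arbitrarily small
  cells, and removing it from such a cell leaves a connected set: this reduces by similarity to
  the connectedness of the gasket minus a single non-vertex point. As the zeros are isolated,
  \<^term>\<open>f\<close> thus has constant sign on a punctured neighbourhood of every zero that is not a vertex.
  Hence each point outside \<^term>\<open>Z0\<close> has a neighbourhood on which \<^term>\<open>f\<close> is of one weak sign.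
  The points of \<^term>\<open>D\<close> of either type form relatively open sets covering \<^term>\<open>D\<close>; they are
  disjoint because near a common point \<^term>\<open>f\<close> would vanish on an infinite set, the gasket
  being perfect. Connectedness of \<^term>\<open>D\<close> concludes.
\<close>

section \<open>The three contractions and the Hutchinson operator\<close>

definition hutchinson :: "(real ^ 2) set \<Rightarrow> (real ^ 2) set" where
  "hutchinson K = (\<Union>i\<in>{0, 1, 2}. F i ` K)"

lemma F_q: "F i (q i) = q i"
  by (simp add: F_def)

text \<open>Both sides are the midpoint of \<open>q i\<close> and \<open>q j\<close>, where the
  cells \<open>i\<close> and \<open>j\<close> touch.\<close>

lemma F_q_swap: "F i (q j) = F j (q i)"
  by (simp add: F_def vec_eq_iff field_simps)

lemma dist_F: "dist (F i x) (F i y) = dist x y / 2"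
proof -
  have "F i x - F i y = (1/2) *\<^sub>R (x - y)"
    by (simp add: F_def algebra_simps)
  then show ?thesis
    by (simp add: dist_norm)
qed

lemma inj_F: "inj (F i)"
  by (rule injI) (simp add: F_def)

lemma continuous_on_F: "continuous_on S (F i)"
  unfolding F_def by (intro continuous_intros)

text \<open>The map on the right inverts \<open>F i\<close>, so openness of images reduces to
  continuity.\<close>

lemma F_image_eq_vimage: "F i ` S = (\<lambda>x. 2 *\<^sub>R x - q i) -` S"
proof (intro set_eqI iffI)
  fix x assume "x \<in> (\<lambda>x. 2 *\<^sub>R x - q i) -` S"
  moreover have "x = F i (2 *\<^sub>R x - q i)"
    by (simp add: F_def vec_eq_iff field_simps)
  ultimately show "x \<in> F i ` S" by blast
next
  fix x assume "x \<in> F i ` S"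
  then obtain y where "y \<in> S" "x = F i y" by blast
  moreover have "2 *\<^sub>R F i y - q i = y"
    by (simp add: F_def vec_eq_iff field_simps)
  ultimately show "x \<in> (\<lambda>x. 2 *\<^sub>R x - q i) -` S" by simp
qed

lemma open_F_image: "open S \<Longrightarrow> open (F i ` S)"
  unfolding F_image_eq_vimage by (intro open_vimage continuous_intros)

lemma hutchinson_mono: "K \<subseteq> L \<Longrightarrow> hutchinson K \<subseteq> hutchinson L"
  unfolding hutchinson_def by blast

lemma compact_hutchinson: "compact K \<Longrightarrow> compact (hutchinson K)"
  unfolding hutchinson_def
  by (intro compact_UN compact_continuous_image continuous_on_F) auto

lemma V0_eq: "V0 = q ` {0, 1, 2}"
  by (simp add: V0_def)

lemma q_in_V0: "i \<in> {0, 1, 2} \<Longrightarrow> q i \<in> V0"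
  unfolding V0_eq by (rule imageI)

lemma V0_subset_hutchinson:
  assumes "V0 \<subseteq> K"
  shows "V0 \<subseteq> hutchinson K"
proof
  fix x assume "x \<in> V0"
  then obtain i where "i \<in> {0, 1, 2}" "x = F i x"
    unfolding V0_eq using F_q by (metis imageE)
  then show "x \<in> hutchinson K"
    unfolding hutchinson_def using assms \<open>x \<in> V0\<close> by blast
qed

text \<open>Two copies \<open>k\<close> and \<open>j\<close> share the midpoint
  \<open>F k (q j) = F j (q k)\<close>. Joining every copy to a fixed copy \<open>k\<close> gives
  connected sets that all contain \<open>F k (q 0)\<close>. A general \<open>J\<close> covers both
  the whole operator and the union with one cell left out.\<close>

lemma connected_Union_F:
  assumes "connected S" "V0 \<subseteq> S" "J \<subseteq> {0, 1, 2}"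
  shows "connected (\<Union>j\<in>J. F j ` S)"
proof (cases "J = {}")
  case False
  then obtain k where k: "k \<in> J" by blast
  have con: "connected (F j ` S)" for j
    by (rule connected_continuous_image[OF continuous_on_F assms(1)])
  have "connected (\<Union>j\<in>J. F k ` S \<union> F j ` S)"
  proof (rule connected_Union)
    fix X assume "X \<in> (\<lambda>j. F k ` S \<union> F j ` S) ` J"
    then obtain j where j: "j \<in> J" "X = F k ` S \<union> F j ` S" by blast
    have "F k (q j) \<in> F k ` S" "F k (q j) \<in> F j ` S"
      using j(1) k assms(2,3) q_in_V0 F_q_swap[of k j] by blast+
    then show "connected X"
      unfolding j(2) by (intro connected_Un con) blast
  next
    have "q 0 \<in> S"
      using assms(2) by (simp add: V0_def)
    then show "\<Inter> ((\<lambda>j. F k ` S \<union> F j ` S) ` J) \<noteq> {}" by blast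
  qed
  also have "(\<Union>j\<in>J. F k ` S \<union> F j ` S) = (\<Union>j\<in>J. F j ` S)"
    using k by blast
  finally show ?thesis .
qed simp

text \<open>A point of \<open>K\<close> farthest from \<open>L\<close> is the image under some
  \<open>F i\<close> of another point of \<open>K\<close>. As \<open>F i\<close> halves distances
  and maps \<open>L\<close> into itself, the maximal distance is at most half of itself, hence zero.
  Used in both directions, this gives uniqueness of the fixed set.\<close>

lemma hutchinson_fixed_subset:
  assumes K: "compact K" "K = hutchinson K"
    and L: "L \<noteq> {}" "closed L" "L = hutchinson L"
  shows "K \<subseteq> L"
proof (cases "K = {}")
  case False
  have "continuous_on K (\<lambda>x. infdist x L)"
    by (intro continuous_intros)
  then obtain x where x: "x \<in> K" "\<And>y. y \<in> K \<Longrightarrow> infdist y L \<le> infdist x L"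
    using continuous_attains_sup[OF K(1) False] by blast
  obtain i y where y: "i \<in> {0, 1, 2}" "y \<in> K" "x = F i y"
    using x(1) K(2) unfolding hutchinson_def by blast
  obtain z where z: "z \<in> L" "infdist y L = dist y z"
    using infdist_attains_inf[OF L(2,1)] by blast
  have "F i z \<in> L"
    using z(1) y(1) L(3) unfolding hutchinson_def by blast
  then have "infdist x L \<le> dist (F i y) (F i z)"
    unfolding y(3) by (rule infdist_le)
  also have "\<dots> \<le> infdist x L / 2"
    using x(2)[OF y(2)] by (simp add: dist_F z(2))
  finally have "infdist x L \<le> 0" by simp
  then have "infdist w L = 0" if "w \<in> K" for w
    using x(2)[OF that] infdist_nonneg[of w L] by linarith
  then show ?thesis
    using in_closed_iff_infdist_zero[OF L(2,1)] by blast
qed simp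

section \<open>The gasket as the intersection of decreasing approximations\<close>

definition approx :: "nat \<Rightarrow> (real ^ 2) set" where
  "approx n = (hutchinson ^^ n) (convex hull V0)"

lemma approx_0: "approx 0 = convex hull V0"
  and approx_Suc: "approx (Suc n) = hutchinson (approx n)"
  by (simp_all add: approx_def)

text \<open>\<open>F i x\<close> is the midpoint of \<open>x\<close> and \<open>q i\<close>, so
  convexity keeps it in the triangle; monotonicity of the operator passes this on to later
  stages.\<close>

lemma approx_Suc_subset: "approx (Suc n) \<subseteq> approx n"
proof (induction n)
  case 0
  have "F i x \<in> convex hull V0" if "i \<in> {0, 1, 2}" "x \<in> convex hull V0" for i x
  proof -
    have "q i \<in> convex hull V0"
      using q_in_V0[OF that(1)] by (rule hull_inc)
    then have "(1/2) *\<^sub>R x + (1/2) *\<^sub>R q i \<in> convex hull V0"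
      using that(2) by (intro convexD[OF convex_convex_hull]) auto
    moreover have "F i x = (1/2) *\<^sub>R x + (1/2) *\<^sub>R q i"
      by (simp add: F_def vec_eq_iff field_simps)
    ultimately show ?thesis by simp
  qed
  then show ?case
    unfolding approx_0 approx_Suc hutchinson_def by blast
next
  case (Suc n)
  then show ?case
    by (metis approx_Suc hutchinson_mono)
qed

lemma approx_antimono: "m \<le> n \<Longrightarrow> approx n \<subseteq> approx m"
  using lift_Suc_antimono_le[of approx] approx_Suc_subset by blast

lemma V0_subset_approx: "V0 \<subseteq> approx n"
  by (induction n) (auto simp: approx_0 approx_Suc hull_inc dest: V0_subset_hutchinson)

lemma compact_approx: "compact (approx n)"
proof (induction n)
  case 0
  show ?case
    unfolding approx_0 by (intro finite_imp_compact_convex_hull) (simp add: V0_def)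
qed (simp add: approx_Suc compact_hutchinson)

lemma connected_approx: "connected (approx n)"
proof (induction n)
  case 0
  show ?case
    unfolding approx_0 by (intro convex_connected convex_convex_hull)
next
  case (Suc n)
  then show ?case
    unfolding approx_Suc hutchinson_def
    by (intro connected_Union_F V0_subset_approx) auto
qed

lemma hutchinson_Inter_approx: "hutchinson (\<Inter>n. approx n) = (\<Inter>n. approx n)"
proof
  have "hutchinson (\<Inter>n. approx n) \<subseteq> approx (Suc n)" for n
    unfolding approx_Suc by (intro hutchinson_mono) blast
  then show "hutchinson (\<Inter>n. approx n) \<subseteq> (\<Inter>n. approx n)"
    using approx_Suc_subset by blast
next
  show "(\<Inter>n. approx n) \<subseteq> hutchinson (\<Inter>n. approx n)"
  proof
    fix x assume x: "x \<in> (\<Inter>n. approx n)"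
    \<comment> \<open>The cell containing \<open>x\<close> could change with the stage. If every
      index failed at some stage, then, the stages being decreasing, all three would fail at the
      latest of these.\<close>
    have "\<exists>i\<in>{0, 1, 2}. \<forall>n. x \<in> F i ` approx n"
    proof (rule ccontr)
      assume "\<not> ?thesis"
      then obtain n where n: "\<And>i. i \<in> {0, 1, 2} \<Longrightarrow> x \<notin> F i ` approx (n i)"
        by metis
      define N where "N = Max (n ` {0, 1, 2})"
      have "x \<notin> F i ` approx N" if i: "i \<in> {0, 1, 2}" for i
      proof -
        have "n i \<le> N"
          using i unfolding N_def by (intro Max_ge) auto
        then show ?thesis
          using n[OF i] approx_antimono by blast
      qed
      then have "x \<notin> approx (Suc N)"
        unfolding approx_Suc hutchinson_def by blast
      then show False using x by blast
    qed
    then obtain i where i: "i \<in> {0, 1, 2}" "\<And>n. x \<in> F i ` approx n" by blast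
    then have "x \<in> (\<Inter>n. F i ` approx n)" by blast
    also have "\<dots> = F i ` (\<Inter>n. approx n)"
      by (rule image_INT[symmetric, OF inj_F]) auto
    finally show "x \<in> hutchinson (\<Inter>n. approx n)"
      using i(1) unfolding hutchinson_def by blast
  qed
qed

lemma SG_eq_Inter_approx: "SG = (\<Inter>n. approx n)"
  unfolding SG_def hutchinson_def[symmetric]
proof (rule the_equality)
  have "q 0 \<in> (\<Inter>n. approx n)"
    using V0_subset_approx by (auto simp: V0_def)
  moreover have "compact (\<Inter>n. approx n)"
    by (intro compact_Inter) (auto simp: compact_approx)
  ultimately show *: "(\<Inter>n. approx n) \<noteq> {} \<and> compact (\<Inter>n. approx n) \<and>
      (\<Inter>n. approx n) = hutchinson (\<Inter>n. approx n)"
    using hutchinson_Inter_approx by blast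
  fix K assume "K \<noteq> {} \<and> compact K \<and> K = hutchinson K"
  with * show "K = (\<Inter>n. approx n)"
    by (metis hutchinson_fixed_subset compact_imp_closed subset_antisym)
qed

section \<open>Topology of the gasket\<close>

lemma SG_fixed: "SG = (\<Union>i\<in>{0, 1, 2}. F i ` SG)"
  using hutchinson_Inter_approx unfolding SG_eq_Inter_approx hutchinson_def by simp

lemma F_in_SG: "i \<in> {0, 1, 2} \<Longrightarrow> x \<in> SG \<Longrightarrow> F i x \<in> SG"
  using SG_fixed by blast

lemma compact_SG: "compact SG"
  unfolding SG_eq_Inter_approx by (intro compact_Inter) (auto simp: compact_approx)

lemma V0_subset_SG: "V0 \<subseteq> SG"
  unfolding SG_eq_Inter_approx using V0_subset_approx by blast

lemma connected_SG: "connected SG"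
  unfolding SG_eq_Inter_approx
  by (intro connected_nest compact_approx connected_approx approx_antimono)

lemma q_0_neq_q_1: "q 0 \<noteq> q 1"
  by (simp add: q_def vec_eq_iff forall_2)

text \<open>A connected set with two distinct points, here \<open>q 0\<close> and
  \<open>q 1\<close>, has no isolated point.\<close>

lemma islimpt_SG: "x \<in> SG \<Longrightarrow> x islimpt SG"
proof (rule connected_imp_perfect[OF connected_SG])
  show "SG \<noteq> {a}" for a
    using subsetD[OF V0_subset_SG q_in_V0[of 0]] subsetD[OF V0_subset_SG q_in_V0[of 1]] q_0_neq_q_1
    by (metis insertCI singletonD)
qed

subsection \<open>Intersections of cells\<close>

text \<open>The cell \<^term>\<open>F i ` SG\<close> lies in the half-plane where the \<^term>\<open>i\<close>-th barycentric
  coordinate is at least 1/2, so on the intersection of two cells all coordinates are forced.\<close>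

definition bary :: "nat \<Rightarrow> real ^ 2 \<Rightarrow> real" where
  "bary i x = (if i = 0 then 2 * x $ 2 / sqrt 3
               else if i = 1 then 1 - x $ 1 - x $ 2 / sqrt 3
               else x $ 1 - x $ 2 / sqrt 3)"

lemma sum_bary: "(\<Sum>i\<in>{0, 1, 2}. bary i x) = 1"
  by (simp add: bary_def)

lemma bary_q: "i \<in> {0, 1, 2} \<Longrightarrow> j \<in> {0, 1, 2} \<Longrightarrow> bary i (q j) = (if i = j then 1 else 0)"
  by (auto simp: bary_def q_def)

lemma bary_affine:
  assumes "u + v = 1"
  shows "bary i (u *\<^sub>R x + v *\<^sub>R y) = u * bary i x + v * bary i y"
proof -
  have u: "u = 1 - v" using assms by simp
  show ?thesis
    unfolding u by (simp add: bary_def field_simps)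
qed

lemma bary_F:
  assumes "i \<in> {0, 1, 2}" "j \<in> {0, 1, 2}"
  shows "bary i (F j x) = (bary i x + (if i = j then 1 else 0)) / 2"
proof -
  have "F j x = (1/2) *\<^sub>R x + (1/2) *\<^sub>R q j"
    by (simp add: F_def vec_eq_iff field_simps)
  then show ?thesis
    by (simp only: bary_affine bary_q[OF assms]) (simp add: bary_affine)
qed

lemma bary_eqI:
  assumes "\<And>i. i \<in> {0, 1, 2} \<Longrightarrow> bary i x = bary i y"
  shows "x = y"
  using assms[of 0] assms[of 2] by (simp add: bary_def vec_eq_iff forall_2)

text \<open>The half-plane is convex and contains the corners, hence the triangle
  \<open>approx 0\<close> and with it the gasket.\<close>

lemma bary_nonneg:
  assumes "i \<in> {0, 1, 2}" "x \<in> SG"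
  shows "bary i x \<ge> 0"
proof -
  have "convex {x. bary i x \<ge> 0}"
  proof (rule convexI)
    fix x y :: "real ^ 2" and u v :: real
    assume *: "x \<in> {x. bary i x \<ge> 0}" "y \<in> {x. bary i x \<ge> 0}" "0 \<le> u" "0 \<le> v" "u + v = 1"
    then show "u *\<^sub>R x + v *\<^sub>R y \<in> {x. bary i x \<ge> 0}"
      by (simp add: bary_affine)
  qed
  moreover have "V0 \<subseteq> {x. bary i x \<ge> 0}"
    using assms(1) bary_q[of i] by (auto simp: V0_def)
  ultimately have "convex hull V0 \<subseteq> {x. bary i x \<ge> 0}"
    by (rule hull_minimal[rotated])
  moreover have "x \<in> convex hull V0"
    using assms(2) unfolding SG_eq_Inter_approx approx_0[symmetric] by blast
  ultimately show ?thesis by blast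
qed

lemma F_SG_Int_F_SG:
  assumes "i \<in> {0, 1, 2}" "j \<in> {0, 1, 2}" "i \<noteq> j" "x \<in> F i ` SG" "x \<in> F j ` SG"
  shows "x = F i (q j)"
proof (rule bary_eqI)
  have half: "bary k x \<ge> 1/2" if k: "k \<in> {0, 1, 2}" and x: "x \<in> F k ` SG" for k
  proof -
    obtain y where y: "y \<in> SG" "x = F k y"
      using x by blast
    show ?thesis
      unfolding y(2) bary_F[OF k k] using bary_nonneg[OF k y(1)] by simp
  qed
  have ge: "bary i x \<ge> 1/2" "bary j x \<ge> 1/2"
    using half assms by blast+
  have nn: "bary k x \<ge> 0" if "k \<in> {0, 1, 2}" for k
    using that assms(1,4) F_in_SG bary_nonneg by blast
  \<comment> \<open>Two coordinates are at least 1/2, the third is nonnegative and the sum is 1: the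
    values are 1/2, 1/2, 0, those of the midpoint.\<close>
  fix k :: nat assume k: "k \<in> {0, 1, 2}"
  then show "bary k x = bary k (F i (q j))"
    using assms(1-3) ge nn[of 0] nn[of 1] nn[of 2] sum_bary[of x] by (auto simp: bary_F bary_q)
qed

section \<open>Vertices, and the cells other than a given one\<close>

lemma F_in_Vstar: "i \<in> {0, 1, 2} \<Longrightarrow> x \<in> Vstar \<Longrightarrow> F i x \<in> Vstar"
proof -
  assume i: "i \<in> {0, 1, 2}" and "x \<in> Vstar"
  then obtain m w v where *: "w \<in> words m" "v \<in> V0" "x = F_word w v"
    unfolding Vstar_def V_def by blast
  have "i # w \<in> words (Suc m)" "F i x = F_word (i # w) v"
    using i * by (auto simp: words_def)
  then show ?thesis
    using *(2) unfolding Vstar_def V_def by blast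
qed

lemma q_in_Vstar: "i \<in> {0, 1, 2} \<Longrightarrow> q i \<in> Vstar"
proof -
  assume "i \<in> {0, 1, 2}"
  then have "q i \<in> V 0"
    using q_in_V0 by (auto simp: V_def words_def)
  then show ?thesis
    unfolding Vstar_def by blast
qed

text \<open>A closed and connected substitute for the complement of the cell \<open>i\<close> in the
  gasket; it also contains the two points where that cell touches the others.\<close>

definition other_cells :: "nat \<Rightarrow> (real ^ 2) set" where
  "other_cells i = (\<Union>j\<in>{0, 1, 2} - {i}. F j ` SG)"

lemma other_cells_subset: "other_cells i \<subseteq> SG"
  unfolding other_cells_def using F_in_SG by blast

lemma connected_other_cells: "connected (other_cells i)"
  unfolding other_cells_def
  by (intro connected_Union_F connected_SG V0_subset_SG) auto

lemma closed_other_cells: "closed (other_cells i)"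
  unfolding other_cells_def
  by (intro closed_UN) (auto intro!: compact_imp_closed compact_continuous_image continuous_on_F compact_SG)

lemma q_in_other_cells: "j \<in> {0, 1, 2} - {i} \<Longrightarrow> q j \<in> other_cells i"
  unfolding other_cells_def using q_in_V0[of j] V0_subset_SG
  by (intro UN_I[of j] image_eqI[of _ _ "q j"]) (auto simp: F_q)

lemma F_q_in_other_cells:
  "i \<in> {0, 1, 2} \<Longrightarrow> j \<in> {0, 1, 2} - {i} \<Longrightarrow> F i (q j) \<in> other_cells i"
  unfolding other_cells_def using q_in_V0[of i] V0_subset_SG
  by (intro UN_I[of j] image_eqI[of _ _ "q i"]) (auto simp: F_q_swap[of i j])

lemma SG_cases:
  assumes "i \<in> {0, 1, 2}"
  shows "SG = F i ` SG \<union> other_cells i"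
proof -
  have "SG = (\<Union>j\<in>insert i ({0, 1, 2} - {i}). F j ` SG)"
    using SG_fixed insert_Diff[OF assms] by simp
  then show ?thesis
    unfolding other_cells_def by (simp only: UN_insert)
qed

text \<open>Distinct cells meet only in the points \<open>F i (q j)\<close>, which are
  vertices.\<close>

lemma notin_other_cells:
  assumes "i \<in> {0, 1, 2}" "x \<in> F i ` SG" "x \<notin> Vstar"
  shows "x \<notin> other_cells i"
proof
  assume "x \<in> other_cells i"
  then obtain j where j: "j \<in> {0, 1, 2} - {i}" "x \<in> F j ` SG"
    unfolding other_cells_def by (rule UN_E)
  have "x = F i (q j)"
    using j(1) by (intro F_SG_Int_F_SG[OF assms(1) _ _ assms(2) j(2)]) simp_all
  moreover have "F i (q j) \<in> Vstar"
    using j(1) by (intro F_in_Vstar[OF assms(1)] q_in_Vstar) simp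
  ultimately show False
    using assms(3) by simp
qed

subsection \<open>Removing a point that is not a vertex\<close>

lemma SG_bound:
  obtains B where "\<And>x y. x \<in> SG \<Longrightarrow> y \<in> SG \<Longrightarrow> dist x y \<le> B"
  using diameter_bounded_bound[OF compact_imp_bounded[OF compact_SG]] that by blast

text \<open>A point is in general linked to only two of the three corners before the recursion into
  subcells has come to an end; two suffice, since any two pairs of corners share a corner.\<close>

lemma connected_component_corners:
  assumes B: "\<And>x y. x \<in> SG \<Longrightarrow> y \<in> SG \<Longrightarrow> dist x y \<le> B"
    and "x \<in> SG" "x \<notin> Vstar" "y \<in> SG" "dist x y * 2 ^ n > B"
  shows "\<exists>i\<in>{0, 1, 2}. \<forall>j\<in>{0, 1, 2} - {i}. connected_component (SG - {x}) y (q j)"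
  using assms(2-)
proof (induction n arbitrary: x y)
  case 0
  then show ?case using B[of x y] by simp
next
  case (Suc n)
  obtain i x' where x': "i \<in> {0, 1, 2}" "x' \<in> SG" "x = F i x'"
    using Suc.prems(1) SG_fixed by blast
  have W: "other_cells i \<subseteq> SG - {x}"
    using notin_other_cells[OF x'(1), of x] x' Suc.prems(2) other_cells_subset by blast
  have link: "connected_component (SG - {x}) u v" if "u \<in> other_cells i" "v \<in> other_cells i" for u v
    using that W connected_other_cells[of i] unfolding connected_component_def by blast
  \<comment> \<open>Reaching \<open>other_cells i\<close> suffices: it is connected, avoids
    \<open>x\<close> and contains both corners other than \<open>q i\<close>.\<close>
  have "\<exists>u\<in>other_cells i. connected_component (SG - {x}) y u"
  proof (cases "y \<in> other_cells i")
    case False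
    then obtain y' where y': "y' \<in> SG" "y = F i y'"
      using Suc.prems(3) SG_cases[OF x'(1)] by blast
    have "x' \<notin> Vstar"
      using Suc.prems(2) F_in_Vstar x' by blast
    \<comment> \<open>Pulling back to the cell doubles the distance, which pays for lowering the
      exponent by one.\<close>
    moreover have "dist x' y' * 2 ^ n > B"
      using Suc.prems(4) by (simp add: x' y' dist_F)
    ultimately obtain k where k: "k \<in> {0, 1, 2}"
        "\<And>j. j \<in> {0, 1, 2} - {k} \<Longrightarrow> connected_component (SG - {x'}) y' (q j)"
      using Suc.IH[OF x'(2) _ y'(1)] by metis
    \<comment> \<open>The corner must differ from \<open>k\<close> to be linked to
      \<open>y'\<close>, and from \<open>i\<close> so that its image under \<open>F i\<close> lies
      in another cell.\<close>
    have "\<exists>j\<in>{0, 1, 2}. j \<noteq> i \<and> j \<noteq> k"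
      using x'(1) k(1) by auto
    then obtain j where j: "j \<in> {0, 1, 2} - {i}" "j \<in> {0, 1, 2} - {k}" by blast
    obtain C where C: "connected C" "C \<subseteq> SG - {x'}" "y' \<in> C" "q j \<in> C"
      using k(2)[OF j(2)] unfolding connected_component_def by blast
    have "connected (F i ` C)"
      by (rule connected_continuous_image[OF continuous_on_F C(1)])
    moreover have "F i ` C \<subseteq> SG - {x}"
      using C(2) F_in_SG[OF x'(1)] injD[OF inj_F[of i]] x'(3) by blast
    ultimately have "connected_component (SG - {x}) y (F i (q j))"
      unfolding connected_component_def using C(3,4) y'(2) by blast
    then show ?thesis
      using F_q_in_other_cells[OF x'(1) j(1)] by blast
  qed (use link in blast)
  then show ?case
    using link q_in_other_cells x'(1) connected_component_trans by meson
qed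

lemma connected_SG_minus_point:
  assumes "x \<in> SG" "x \<notin> Vstar"
  shows "connected (SG - {x})"
proof -
  obtain B where B: "\<And>x y. x \<in> SG \<Longrightarrow> y \<in> SG \<Longrightarrow> dist x y \<le> B"
    using SG_bound by blast
  have corners: "\<exists>i\<in>{0, 1, 2}. \<forall>j\<in>{0, 1, 2} - {i}. connected_component (SG - {x}) y (q j)"
    if y: "y \<in> SG - {x}" for y
  proof -
    have "dist x y > 0" using y by auto
    \<comment> \<open>A depth at which the required separation exceeds the diameter bound.\<close>
    obtain n where "B / dist x y < 2 ^ n"
      using real_arch_pow[of 2] by auto
    then have "dist x y * 2 ^ n > B"
      using \<open>dist x y > 0\<close> by (simp add: field_simps)
    then show ?thesis
      using connected_component_corners[OF B assms] y by blast
  qed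
  have "connected_component (SG - {x}) y z" if y: "y \<in> SG - {x}" and z: "z \<in> SG - {x}" for y z
  proof -
    obtain i where i: "i \<in> {0, 1, 2}"
      "\<And>j. j \<in> {0, 1, 2} - {i} \<Longrightarrow> connected_component (SG - {x}) y (q j)"
      using corners[OF y] by blast
    obtain k where k: "k \<in> {0, 1, 2}"
      "\<And>j. j \<in> {0, 1, 2} - {k} \<Longrightarrow> connected_component (SG - {x}) z (q j)"
      using corners[OF z] by blast
    have "\<exists>j\<in>{0, 1, 2}. j \<noteq> i \<and> j \<noteq> k"
      using i(1) k(1) by auto
    then obtain j where j: "j \<in> {0, 1, 2} - {i}" "j \<in> {0, 1, 2} - {k}" by blast
    show ?thesis
      using connected_component_trans[OF i(2)[OF j(1)] connected_component_sym[OF k(2)[OF j(2)]]] .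
  qed
  then show ?thesis
    unfolding connected_iff_connected_component by blast
qed

text \<open>\<open>C\<close> is a cell of level \<open>n\<close> around \<open>x\<close>, a similar
  copy of the gasket, so deleting \<open>x\<close> corresponds to deleting a non-vertex point from
  the gasket itself. The open set \<open>T\<close> records that \<open>C\<close> is a neighbourhood
  of \<open>x\<close> relative to the gasket.\<close>

lemma cell_neighbourhood:
  assumes B: "\<And>x y. x \<in> SG \<Longrightarrow> y \<in> SG \<Longrightarrow> dist x y \<le> B"
    and "x \<in> SG" "x \<notin> Vstar"
  shows "\<exists>T C. open T \<and> x \<in> T \<and> T \<inter> SG \<subseteq> C \<and> C \<subseteq> SG \<inter> cball x (B / 2 ^ n) \<and> connected (C - {x})"
  using assms(2-)
proof (induction n arbitrary: x)
  case 0
  then show ?case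
    using B connected_SG_minus_point by (intro exI[of _ UNIV] exI[of _ SG]) auto
next
  case (Suc n)
  obtain i y where y: "i \<in> {0, 1, 2}" "y \<in> SG" "x = F i y"
    using Suc.prems(1) SG_fixed by blast
  moreover have "y \<notin> Vstar"
    using Suc.prems(2) F_in_Vstar y by blast
  ultimately obtain T C where TC: "open T" "y \<in> T" "T \<inter> SG \<subseteq> C"
      "C \<subseteq> SG \<inter> cball y (B / 2 ^ n)" "connected (C - {y})"
    using Suc.IH by metis
  have eq: "F i ` C - {x} = F i ` (C - {y})"
    using injD[OF inj_F[of i]] y(3) by blast
  show ?case
  proof (intro exI conjI)
    \<comment> \<open>The image of \<open>T\<close> may reach into neighbouring cells; removing
      these closed cells confines it, within the gasket, to the cell \<open>i\<close>. The point
      \<open>x\<close> survives because it is not a vertex.\<close>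
    show "open (F i ` T - other_cells i)"
      by (intro open_Diff open_F_image TC closed_other_cells)
    show "x \<in> F i ` T - other_cells i"
      using TC(2) y notin_other_cells Suc.prems(2) by blast
    show "(F i ` T - other_cells i) \<inter> SG \<subseteq> F i ` C"
      using SG_cases[OF y(1)] TC(3) injD[OF inj_F[of i]] by blast
    show "F i ` C \<subseteq> SG \<inter> cball x (B / 2 ^ Suc n)"
      using TC(4) F_in_SG[OF y(1)] by (auto simp: y(3) dist_F field_simps)
    show "connected (F i ` C - {x})"
      unfolding eq by (rule connected_continuous_image[OF continuous_on_F TC(5)])
  qed
qed

section \<open>From local signs to the sign on a component\<close>

lemma connected_nonzero_sign:
  fixes f :: "'a::topological_space \<Rightarrow> real"
  assumes "connected S" "continuous_on S f" "\<And>x. x \<in> S \<Longrightarrow> f x \<noteq> 0"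
  shows "(\<forall>x\<in>S. f x > 0) \<or> (\<forall>x\<in>S. f x < 0)"
proof (rule ccontr)
  assume "\<not> ?thesis"
  then obtain x y where xy: "x \<in> S" "y \<in> S" "f x \<le> 0" "0 \<le> f y"
    by (meson linorder_not_less)
  have "connected (f ` S)"
    using connected_continuous_image assms by blast
  then have "0 \<in> f ` S"
    using connectedD_interval[of "f ` S" "f x" "f y" 0] xy by blast
  then show False
    using assms(3) by auto
qed

lemma local_sign:
  fixes f :: "real ^ 2 \<Rightarrow> real"
  assumes f: "continuous_on SG f" and fin: "finite {x \<in> SG. f x = 0}"
    and x: "x \<in> SG" "f x = 0 \<Longrightarrow> x \<notin> Vstar"
  shows "\<exists>T. open T \<and> x \<in> T \<and> ((\<forall>y\<in>T \<inter> SG. f y \<ge> 0) \<or> (\<forall>y\<in>T \<inter> SG. f y \<le> 0))"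
proof (cases "f x = 0")
  case False
  \<comment> \<open>With tolerance \<open>\<bar>f x\<bar>\<close>, the value \<open>f y\<close>
    stays on the same side of zero as \<open>f x\<close>.\<close>
  obtain d where d: "d > 0" "\<And>y. y \<in> SG \<Longrightarrow> dist y x < d \<Longrightarrow> dist (f y) (f x) < \<bar>f x\<bar>"
    using f x(1) False unfolding continuous_on_iff by (metis zero_less_abs_iff)
  have "\<bar>f y - f x\<bar> < \<bar>f x\<bar>" if "y \<in> ball x d \<inter> SG" for y
    using d(2)[of y] that by (simp add: dist_commute dist_real_def)
  then have "(\<forall>y\<in>ball x d \<inter> SG. f y \<ge> 0) \<or> (\<forall>y\<in>ball x d \<inter> SG. f y \<le> 0)"
    by (cases "f x > 0") (fastforce simp: abs_if split: if_splits)+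
  then show ?thesis
    using d(1) by (intro exI[of _ "ball x d"]) auto
next
  case True
  obtain B where B: "\<And>x y. x \<in> SG \<Longrightarrow> y \<in> SG \<Longrightarrow> dist x y \<le> B"
    using SG_bound by blast
  obtain d where d: "d > 0" "\<And>y. y \<in> SG \<Longrightarrow> f y = 0 \<Longrightarrow> y \<noteq> x \<Longrightarrow> d \<le> dist x y"
    using finite_set_avoid[OF fin, of x] by auto
  \<comment> \<open>The cell is made smaller than the distance \<open>d\<close> to the other zeros,
    so that \<open>x\<close> is the only zero in it.\<close>
  obtain n where "B / d < 2 ^ n"
    using real_arch_pow[of 2] by auto
  then have n: "B / 2 ^ n < d"
    using d(1) by (simp add: field_simps)
  obtain T C where TC: "open T" "x \<in> T" "T \<inter> SG \<subseteq> C" "C \<subseteq> SG \<inter> cball x (B / 2 ^ n)"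
      "connected (C - {x})"
    using cell_neighbourhood[OF B x(1) x(2)[OF True], of n] by blast
  have "(\<forall>y\<in>C - {x}. f y > 0) \<or> (\<forall>y\<in>C - {x}. f y < 0)"
  proof (rule connected_nonzero_sign[OF TC(5)])
    show "continuous_on (C - {x}) f"
      using f by (rule continuous_on_subset) (use TC(4) in blast)
    show "f y \<noteq> 0" if "y \<in> C - {x}" for y
      using d(2)[of y] that TC(4) n by force
  qed
  moreover have "f y = 0 \<or> y \<in> C - {x}" if "y \<in> T \<inter> SG" for y
    using that TC(3) True by blast
  ultimately have "(\<forall>y\<in>T \<inter> SG. f y \<ge> 0) \<or> (\<forall>y\<in>T \<inter> SG. f y \<le> 0)"
    by (metis less_imp_le order_refl)
  then show ?thesis
    using TC(1,2) by blast
qed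

theorem proposition2p1:
  fixes f :: "real ^ 2 \<Rightarrow> real" and Z Z0 D :: "(real ^ 2) set"
  assumes "continuous_on SG f"
    and "Z = {x \<in> SG. f x = 0}"
    and "finite Z"
    and "Z0 = Z \<inter> Vstar"
    and "D \<in> components (SG - Z0)"
  shows "(\<forall>x\<in>D. f x \<ge> 0) \<or> (\<forall>x\<in>D. f x \<le> 0)"
proof -
  have D: "connected D" "D \<subseteq> SG - Z0"
    using assms(5) in_components_connected in_components_subset by blast+
  \<comment> \<open>\<open>P\<close> and \<open>N\<close> are the largest open sets of the plane on
    whose trace in the gasket \<open>f\<close> has the given weak sign.\<close>
  define P where "P = \<Union>{T. open T \<and> (\<forall>y\<in>T \<inter> SG. f y \<ge> 0)}"
  define N where "N = \<Union>{T. open T \<and> (\<forall>y\<in>T \<inter> SG. f y \<le> 0)}"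
  have "open P" "open N"
    unfolding P_def N_def by auto
  moreover have "D \<subseteq> P \<union> N"
  proof
    fix x assume "x \<in> D"
    then have x: "x \<in> SG" "f x = 0 \<Longrightarrow> x \<notin> Vstar"
      using D(2) assms(2,4) by auto
    show "x \<in> P \<union> N"
      using local_sign[OF assms(1) assms(3)[unfolded assms(2)] x]
      unfolding P_def N_def by blast
  qed
  moreover have "P \<inter> N \<inter> D = {}"
  proof (rule ccontr)
    assume "P \<inter> N \<inter> D \<noteq> {}"
    then obtain x where x: "x \<in> P" "x \<in> N" "x \<in> SG"
      using D(2) by blast
    have "open (P \<inter> N)"
      using \<open>open P\<close> \<open>open N\<close> by (rule open_Int)
    \<comment> \<open>Since \<open>x\<close> is a limit point of the gasket, the open set
      \<open>P \<inter> N\<close> contains infinitely many gasket points, and \<open>f\<close>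
      vanishes at all of them.\<close>
    then have "infinite (P \<inter> N \<inter> SG)"
      using islimpt_SG[OF x(3)] x(1,2) unfolding islimpt_eq_acc_point by simp
    moreover have "P \<inter> N \<inter> SG \<subseteq> Z"
      unfolding P_def N_def assms(2) by (force intro: order_antisym)
    ultimately show False
      using finite_subset[OF _ assms(3)] by blast
  qed
  ultimately have "P \<inter> D = {} \<or> N \<inter> D = {}"
    using D(1) unfolding connected_def by blast
  then have "D \<subseteq> P \<or> D \<subseteq> N"
    using \<open>D \<subseteq> P \<union> N\<close> by blast
  then show ?thesis
    using D(2) unfolding P_def N_def by blast
qed

end
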